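(* For every $\varepsilon > 0$ and every $x > 0$ there exist $n \in \mathbb{N}$ and growth rates $h_1,\dots,h_n>0$ with $\sum_i h_i = 1$ such that, in the bamboo trimming process run with Reduce-Fastest$(x)$ (with any tie-breaking), some bamboo reaches height at least $x + 1 - \varepsilon$.
   Context: Bamboo trimming problem: bamboo $b_1,\dots,b_n$ with growth rates $h_i>0$, all starting at height $0$; each time step consists of every $b_i$ growing by $h_i$, after which the algorithm cuts at most one bamboo to height $0$. Reduce-Fastest$(x)$: after the growth phase of each step, among bamboo with height at least $x$, cut one with the largest growth rate (ties broken arbitrarily); if none has height at least $x$, cut nothing. Heights are considered at all times, including after growth and before the cut. *)

theory Defs
  imports Complex_Main
begin

text \<open>Bamboos are indexed by \<open>{1..n}\<close>. A state assigns to each index its height; values at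
  indices outside \<open>{1..n}\<close> are never inspected.\<close>

definition grow :: "(nat \<Rightarrow> real) \<Rightarrow> (nat \<Rightarrow> real) \<Rightarrow> nat \<Rightarrow> real" where
  "grow h H = (\<lambda>i. H i + h i)"

text \<open>The cut is a relation between the heights \<open>G\<close> before and \<open>G'\<close> after it, so that several
  outcomes are possible exactly when growth rates are tied.\<close>

definition reduce_fastest_cut ::
  "nat \<Rightarrow> (nat \<Rightarrow> real) \<Rightarrow> real \<Rightarrow> (nat \<Rightarrow> real) \<Rightarrow> (nat \<Rightarrow> real) \<Rightarrow> bool" where
  "reduce_fastest_cut n h x G G' \<longleftrightarrow>
     (if \<exists>i\<in>{1..n}. G i \<ge> x
      then \<exists>j. is_arg_max h (\<lambda>i. i \<in> {1..n} \<and> G i \<ge> x) j \<and> G' = G(j := 0)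
      else G' = G)"

text \<open>\<open>H t\<close> is the state after \<open>t\<close> complete steps. Since the choices made at different steps are
  independent, the runs cover every tie-breaking rule, including history-dependent ones.\<close>

definition reduce_fastest_run ::
  "nat \<Rightarrow> (nat \<Rightarrow> real) \<Rightarrow> real \<Rightarrow> (nat \<Rightarrow> nat \<Rightarrow> real) \<Rightarrow> bool" where
  "reduce_fastest_run n h x H \<longleftrightarrow>
     H 0 = (\<lambda>i. 0) \<and> (\<forall>t. reduce_fastest_cut n h x (grow h (H t)) (H (Suc t)))"

definition reaches_height ::
  "nat \<Rightarrow> (nat \<Rightarrow> real) \<Rightarrow> (nat \<Rightarrow> nat \<Rightarrow> real) \<Rightarrow> real \<Rightarrow> bool" where
  "reaches_height n h H v \<longleftrightarrow>
     (\<exists>t. \<exists>i\<in>{1..n}. H t i \<ge> v \<or> grow h (H t) i \<ge> v)"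

text \<open>Runs always exist, so quantifying universally over them is never vacuous.\<close>

lemma reduce_fastest_cut_exists: "\<exists>G'. reduce_fastest_cut n h x G G'"
proof (cases "\<exists>i\<in>{1..n}. G i \<ge> x")
  case True
  let ?S = "{i \<in> {1..n}. G i \<ge> x}"
  have "finite (h ` ?S)" "h ` ?S \<noteq> {}" using True by auto
  then have "Max (h ` ?S) \<in> h ` ?S" and le: "\<And>i. i \<in> ?S \<Longrightarrow> h i \<le> Max (h ` ?S)"
    by (rule Max_in, auto)
  then obtain j where j: "j \<in> ?S" "h j = Max (h ` ?S)" by auto
  have "is_arg_max h (\<lambda>i. i \<in> {1..n} \<and> G i \<ge> x) j"
    unfolding is_arg_max_def using j le by (metis (mono_tags, lifting) mem_Collect_eq not_less)
  then show ?thesis unfolding reduce_fastest_cut_def using True by auto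
qed (auto simp: reduce_fastest_cut_def)

lemma reduce_fastest_run_exists: "\<exists>H. reduce_fastest_run n h x H"
proof -
  obtain c where c: "\<And>G. reduce_fastest_cut n h x G (c G)"
    using reduce_fastest_cut_exists by metis
  have "reduce_fastest_run n h x (rec_nat (\<lambda>i. 0) (\<lambda>_ H. c (grow h H)))"
    unfolding reduce_fastest_run_def using c by simp
  then show ?thesis by blast
qed

end

(* With n equal growth rates 1/n all bamboos first reach height x in the same step. Only one of
   them can be cut per step, so whatever the tie-breaking, some bamboo is still uncut after n - 1
   cuts and has grown by almost 1 beyond x. *)
theory Submission imports Defs begin

lemma cut_unchanged_except:
  assumes "reduce_fastest_cut n h x G G'"
  obtains j where "\<And>i. i \<noteq> j \<Longrightarrow> G' i = G i"
proof -
  have "\<exists>j. \<forall>i. i \<noteq> j \<longrightarrow> G' i = G i"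
    using assms unfolding reduce_fastest_cut_def by (auto split: if_splits)
  then show thesis using that by blast
qed

text \<open>Growth rates are positive, so a bound at time \<open>m\<close> also bounds all earlier
  heights. No bamboo reaches \<open>x\<close> by then, every step cuts nothing, and the run is
  forced.\<close>

lemma run_height_before_threshold:
  assumes run: "reduce_fastest_run n h x H"
    and below: "\<And>i. i \<in> {1..n} \<Longrightarrow> real m * h i < x"
    and pos: "\<And>i. i \<in> {1..n} \<Longrightarrow> h i > 0"
    and "t \<le> m"
  shows "H t = (\<lambda>i. real t * h i)"
  using \<open>t \<le> m\<close>
proof (induction t)
  case 0
  then show ?case using run by (simp add: reduce_fastest_run_def)
next
  case (Suc t)
  then have grow: "grow h (H t) = (\<lambda>i. real (Suc t) * h i)"
    by (simp add: grow_def algebra_simps)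
  have "real (Suc t) * h i < x" if "i \<in> {1..n}" for i
  proof -
    have "real (Suc t) * h i \<le> real m * h i"
      using Suc.prems pos[OF that] by (intro mult_right_mono) auto
    then show ?thesis using below[OF that] by linarith
  qed
  then have "\<not> (\<exists>i\<in>{1..n}. grow h (H t) i \<ge> x)"
    unfolding grow by (meson not_le)
  moreover have "reduce_fastest_cut n h x (grow h (H t)) (H (Suc t))"
    using run by (simp add: reduce_fastest_run_def)
  ultimately have "H (Suc t) = grow h (H t)"
    unfolding reduce_fastest_cut_def by (simp only: if_False)
  then show ?case using grow by simp
qed

text \<open>\<open>C\<close> collects the indices altered by cuts in the \<open>k\<close> steps
  after time \<open>m\<close>; each step adds at most one. Only the number of cuts matters, not
  which bamboo is chosen, so tie-breaking plays no part.\<close>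

lemma run_height_except_cut:
  assumes run: "reduce_fastest_run n h x H"
  shows "\<exists>C. finite C \<and> card C \<le> k \<and> (\<forall>i. i \<notin> C \<longrightarrow> H (m + k) i = H m i + real k * h i)"
proof (induction k)
  case 0
  show ?case by (intro exI[of _ "{}"]) simp
next
  case (Suc k)
  then obtain C where C: "finite C" "card C \<le> k"
    "\<And>i. i \<notin> C \<Longrightarrow> H (m + k) i = H m i + real k * h i" by blast
  have "reduce_fastest_cut n h x (grow h (H (m + k))) (H (m + Suc k))"
    using run by (simp add: reduce_fastest_run_def)
  then obtain j where j: "\<And>i. i \<noteq> j \<Longrightarrow> H (m + Suc k) i = grow h (H (m + k)) i"
    by (rule cut_unchanged_except) blast
  have "card (insert j C) \<le> Suc k"
    using C(1,2) by (simp add: card_insert_if)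
  moreover have "H (m + Suc k) i = H m i + real (Suc k) * h i" if "i \<notin> insert j C" for i
    using that j[of i] C(3)[of i] by (simp add: grow_def algebra_simps)
  ultimately show ?case using C(1) by blast
qed

theorem theorem3p2:
  fixes \<epsilon> x :: real
  assumes "\<epsilon> > 0" and "x > 0"
  shows "\<exists>(n :: nat) (h :: nat \<Rightarrow> real).
           (\<forall>i\<in>{1..n}. h i > 0) \<and> (\<Sum>i=1..n. h i) = 1 \<and>
           (\<forall>H. reduce_fastest_run n h x H \<longrightarrow> reaches_height n h H (x + 1 - \<epsilon>))"
proof -
  \<comment> \<open>The final height falls short of \<open>x + 1\<close> by at most
    \<open>1 / real n\<close>.\<close>
  obtain n :: nat where n: "n > 0" "1 / real n < \<epsilon>"
    using reals_Archimedean[OF \<open>\<epsilon> > 0\<close>] by (metis inverse_eq_divide zero_less_Suc)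
  define h :: "nat \<Rightarrow> real" where "h = (\<lambda>_. 1 / real n)"
  \<comment> \<open>The last time at which the uncut height \<open>real m / real n\<close> is
    strictly below \<open>x\<close>. Subtracting 1 from the ceiling, rather than taking the floor,
    keeps this strict when \<open>x * real n\<close> is an integer.\<close>
  define m where "m = nat (\<lceil>x * real n\<rceil> - 1)"
  \<comment> \<open>Positivity makes the ceiling at least 1, so \<open>nat\<close> does not
    truncate.\<close>
  have "x * real n > 0" using assms n by simp
  then have m: "real m < x * real n" "x * real n \<le> real m + 1"
    unfolding m_def by linarith+
  have "reaches_height n h H (x + 1 - \<epsilon>)" if run: "reduce_fastest_run n h x H" for H
  proof -
    have Hm: "H m = (\<lambda>i. real m * h i)"
      using run_height_before_threshold[OF run, of m m] m n by (simp add: h_def field_simps)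
    obtain C where C: "finite C" "card C \<le> n - 1"
      "\<And>i. i \<notin> C \<Longrightarrow> H (m + (n - 1)) i = H m i + real (n - 1) * h i"
      using run_height_except_cut[OF run, of "n - 1" m] by blast
    \<comment> \<open>Pigeonhole: \<open>n - 1\<close> cuts cannot hit all \<open>n\<close>
      bamboos.\<close>
    have "\<not> {1..n} \<subseteq> C"
      using card_mono[OF C(1), of "{1..n}"] C(2) n by auto
    then obtain i where i: "i \<in> {1..n}" "i \<notin> C" by blast
    \<comment> \<open>Measuring after growth but before the next cut gives the survivor an
      \<open>n\<close>-th growth since time \<open>m\<close>: the first brings it to at least
      \<open>x\<close>, the other \<open>n - 1\<close> add \<open>1 - 1 / real n\<close>.\<close>
    have "grow h (H (m + (n - 1))) i = (real m + real n) / real n"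
      using C(3)[OF i(2)] n by (simp add: grow_def Hm h_def of_nat_diff field_simps)
    also have "\<dots> = (real m + 1) / real n + 1 - 1 / real n"
      using n by (simp add: field_simps)
    finally have "grow h (H (m + (n - 1))) i = (real m + 1) / real n + 1 - 1 / real n" .
    moreover have "x \<le> (real m + 1) / real n"
      using m n by (simp add: field_simps)
    ultimately have "grow h (H (m + (n - 1))) i \<ge> x + 1 - \<epsilon>" using n by linarith
    then show ?thesis using i(1) unfolding reaches_height_def by blast
  qed
  moreover have "\<forall>i\<in>{1..n}. h i > 0" "(\<Sum>i=1..n. h i) = 1"
    using n by (simp_all add: h_def)
  ultimately show ?thesis by blast
qed

end
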